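(* Let $S(K)\subset\mathbb{R}^2$ be an element patch with sampling node set $\mathcal{I}(K)\subset S(K)$, and let $g\in C^1(S(K))$. Assume that (1) there exists $\alpha>0$ such that $\|g\|_{L^\infty(S(K))}\le\alpha\|g|_{\mathcal{I}(K)}\|_{\ell_\infty}$; (2) $S(K)$ admits a Markov-type inequality in the sense that there exists $\beta>0$ such that $\|\nabla g\|_{L^\infty(S(K))}\le\beta\|g\|_{L^\infty(S(K))}$. Then for any $\delta\in(0,1)$, there exists $\varepsilon=\delta/(\alpha\beta)$ such that for any sampling node set $\widetilde{\mathcal{I}}(K)$ that is a perturbation of $\mathcal{I}(K)$ in the sense that $\widetilde{\mathcal{I}}(K)\subset\mathcal{I}(K)+B(0,\varepsilon)$, where $B(0,\varepsilon)$ is the disk centered at $0$ with radius $\varepsilon$, the following stability estimate is valid: $$\|g\|_{L^\infty(S(K))}\le\frac{\alpha}{1-\delta}\|g|_{\widetilde{\mathcal{I}}(K)}\|_{\ell_\infty}.$$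
   Context: Let $\mathcal{T}_h$ be a mesh of a planar polygonal domain consisting of (possibly non-convex) polygons. Each element $K\in\mathcal{T}_h$ is assigned a sampling node $x_K\in K$ and an element patch $S(K)$, an agglomeration of $K$ and some elements around $K$. The sampling node set $\mathcal{I}(K)$ consists of the sampling nodes of the elements belonging to $S(K)$, one for each element of the patch. For a finite set $I$ of points, $\|g|_I\|_{\ell_\infty}=\max_{x\in I}|g(x)|$.
   Formalization: The perturbation is taken node by node (each element's new node lies within ε of that element's old node), and the segment joining the old and new node must lie in S(K); without either condition the estimate fails, e.g. when nodes merge at a zero of g, or in a U-shaped polygon. *)

theory Defs
  imports "HOL-Analysis.Analysis" "HOL-Probability.Essential_Supremum"
begin

section \<open>Meshes of possibly non-convex polygons\<close>

fun polygonal_path :: "(real^2) list \<Rightarrow> real \<Rightarrow> real^2" where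
  "polygonal_path [] = linepath 0 0"
| "polygonal_path [a] = linepath a a"
| "polygonal_path [a, b] = linepath a b"
| "polygonal_path (a # b # c # vs) = linepath a b +++ polygonal_path (b # c # vs)"

text \<open>A polygon is the closed region bounded by a simple closed polygonal curve. The vertex list
  repeats the initial vertex at its end.\<close>

definition polygon :: "(real^2) set \<Rightarrow> bool" where
  "polygon K \<longleftrightarrow> (\<exists>vs. simple_path (polygonal_path vs) \<and>
      pathfinish (polygonal_path vs) = pathstart (polygonal_path vs) \<and>
      K = path_image (polygonal_path vs) \<union> inside (path_image (polygonal_path vs)))"

definition polygonal_domain :: "(real^2) set \<Rightarrow> bool" where
  "polygonal_domain \<Omega> \<longleftrightarrow> \<Omega> \<noteq> {} \<and> open \<Omega> \<and> connected \<Omega> \<and> bounded \<Omega> \<and>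
     (\<exists>E. finite E \<and> frontier \<Omega> = (\<Union>(a, b)\<in>E. closed_segment a b))"

text \<open>Elements are closed sets; hanging nodes are allowed.\<close>

definition polygonal_mesh :: "(real^2) set \<Rightarrow> (real^2) set set \<Rightarrow> bool" where
  "polygonal_mesh \<Omega> T \<longleftrightarrow> polygonal_domain \<Omega> \<and> finite T \<and> (\<forall>K\<in>T. polygon K) \<and>
     \<Union>T = closure \<Omega> \<and> pairwise (\<lambda>K L. interior K \<inter> interior L = {}) T"

section \<open>Element patches and sampling nodes\<close>

text \<open>A patch of \<^term>\<open>K\<close> is given by the collection \<^term>\<open>P\<close> of its elements, and \<open>S(K)\<close> is the
  region \<^term>\<open>\<Union>P\<close>. Which neighbouring elements are chosen is left unrestricted.\<close>

definition element_patch :: "(real^2) set set \<Rightarrow> (real^2) set \<Rightarrow> (real^2) set set \<Rightarrow> bool" where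
  "element_patch T K P \<longleftrightarrow> K \<in> P \<and> P \<subseteq> T"

text \<open>One node in each element of \<^term>\<open>P\<close>; the sampling node set is the image \<^term>\<open>x ` P\<close>.\<close>

definition sampling_nodes ::
    "(real^2) set set \<Rightarrow> ((real^2) set \<Rightarrow> real^2) \<Rightarrow> bool" where
  "sampling_nodes P x \<longleftrightarrow> (\<forall>K\<in>P. x K \<in> K)"

text \<open>A perturbation moves the node of each element by less than \<open>\<epsilon>\<close>. The inclusion
  \<open>y ` P \<subseteq> x ` P + B(0, \<epsilon>)\<close> between the node sets would not be enough: it permits all nodes to
  gather around a single point of \<^term>\<open>x ` P\<close>.\<close>

definition node_perturbation :: "(real^2) set set \<Rightarrow> real \<Rightarrow>
    ((real^2) set \<Rightarrow> real^2) \<Rightarrow> ((real^2) set \<Rightarrow> real^2) \<Rightarrow> bool" where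
  "node_perturbation P \<epsilon> x y \<longleftrightarrow> (\<forall>K\<in>P. \<exists>b \<in> ball 0 \<epsilon>. y K = x K + b)"

lemma node_perturbation_image:
  assumes "node_perturbation P \<epsilon> x y"
  shows "y ` P \<subseteq> {p + b | p b. p \<in> x ` P \<and> b \<in> ball 0 \<epsilon>}"
  using assms unfolding node_perturbation_def by blast

section \<open>Continuously differentiable functions and norms\<close>

text \<open>Derivatives are taken within the closed region \<^term>\<open>S\<close>, hence one-sided at its boundary.
  They are unique for regions that are finite unions of polygons.\<close>

definition grad_within :: "(real^2) set \<Rightarrow> (real^2 \<Rightarrow> real) \<Rightarrow> real^2 \<Rightarrow> real^2" where
  "grad_within S g x = (\<chi> i. frechet_derivative g (at x within S) (axis i 1))"

definition C1_on :: "(real^2) set \<Rightarrow> (real^2 \<Rightarrow> real) \<Rightarrow> bool" where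
  "C1_on S g \<longleftrightarrow> g differentiable_on S \<and> continuous_on S (grad_within S g)"

definition Linf_norm :: "(real^2) set \<Rightarrow> (real^2 \<Rightarrow> 'b::real_normed_vector) \<Rightarrow> ereal" where
  "Linf_norm S f = esssup (lebesgue_on S) (\<lambda>x. ereal (norm (f x)))"

definition linf_norm :: "(real^2) set \<Rightarrow> (real^2 \<Rightarrow> real) \<Rightarrow> real" where
  "linf_norm I g = Max ((\<lambda>x. \<bar>g x\<bar>) ` I)"

end

theory Submission
  imports Defs
begin

text \<open>
  Since \<open>g\<close> is differentiable along the segment from \<open>x L\<close> to \<open>y L\<close>, the mean value inequality
  bounds \<open>\<bar>g (x L) - g (y L)\<bar>\<close> by \<open>\<epsilon>\<close> times the supremum of the gradient, hence by
  \<open>\<epsilon> \<beta> \<parallel>g\<parallel> = (\<delta> / \<alpha>) \<parallel>g\<parallel>\<close>. Taking for \<open>L\<close> the element whose node maximises \<open>\<bar>g (x L)\<bar>\<close>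
  yields \<open>\<parallel>g\<parallel> \<le> \<alpha> \<bar>g (y L)\<bar> + \<delta> \<parallel>g\<parallel>\<close>. The segment may run along the boundary of the patch, a null set.
  The essential supremum of the gradient nevertheless bounds it there, because by the Jordan curve
  theorem a polygon lies in the closure of its interior.
\<close>

text \<open>A linear bijection restricts to a homeomorphism of the complements, so it carries
  components to components, and together with its linear inverse it preserves boundedness in both
  directions.\<close>

lemma inside_linear_image:
  fixes f :: "'a::euclidean_space \<Rightarrow> 'b::euclidean_space"
  assumes "linear f" "bij f"
  shows "inside (f ` S) = f ` inside S"
proof -
  have inj: "inj f" and surj: "surj f"
    using \<open>bij f\<close> by (auto simp: bij_def)
  obtain h where h: "linear h" and inv: "\<And>u. h (f u) = u"
    using linear_injective_left_inverse[OF \<open>linear f\<close> inj] by (metis comp_apply id_apply)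
  have Compl: "f ` (- S) = - f ` S"
    by (rule bij_image_Compl_eq[OF \<open>bij f\<close>])
  have homeo: "homeomorphism (- S) (- f ` S) f h"
    unfolding Compl[symmetric] homeomorphism_def using assms h
    by (auto simp: linear_continuous_on linear_conv_bounded_linear image_image inv)
  have bounded: "bounded (f ` A) \<longleftrightarrow> bounded A" for A
    using bounded_linear_image[of A f] bounded_linear_image[of "f ` A" h] assms h
    by (auto simp: linear_conv_bounded_linear image_image inv)
  have "f u \<in> inside (f ` S) \<longleftrightarrow> u \<in> inside S" for u
  proof (cases "u \<in> S")
    case False
    then have "connected_component_set (- f ` S) (f u) = f ` connected_component_set (- S) u"
      by (intro connected_component_set_homeomorphism[OF homeo]) simp
    then show ?thesis
      by (simp add: inside_def bounded inj_image_mem_iff[OF inj])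
  qed (simp add: inside_def)
  then show ?thesis
    using surj by (metis inj_image_mem_iff[OF inj] subsetI subset_antisym surjD)
qed

text \<open>By the Jordan curve theorem, a simple closed curve in \<open>complex\<close> is the
  frontier of its inside. A linear isomorphism between \<open>real^2\<close> and
  \<open>complex\<close> carries this over.\<close>

lemma Jordan_curve_subset_closure_inside:
  fixes c :: "real \<Rightarrow> real^2"
  assumes "simple_path c" "pathfinish c = pathstart c"
  shows "path_image c \<subseteq> closure (inside (path_image c))"
proof -
  have "DIM(real^2) = DIM(complex)"
    by simp
  then obtain f :: "real^2 \<Rightarrow> complex" and h where f: "linear f"
    and inv: "\<And>v. h (f v) = v" "\<And>z. f (h z) = z"
    by (rule isomorphisms_UNIV_UNIV) blast
  have "bij f"
    using inv by (intro o_bij[of h]) auto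
  then have "inj f"
    by (rule bij_is_inj)
  have "f ` path_image c = frontier (inside (f ` path_image c))"
    using Jordan_inside_outside[of "f \<circ> c"] assms
    by (simp add: simple_path_linear_image_eq[OF f \<open>inj f\<close>] path_image_compose pathfinish_compose
        pathstart_compose)
  also have "\<dots> \<subseteq> closure (inside (f ` path_image c))"
    by (simp add: frontier_def)
  also have "\<dots> = f ` closure (inside (path_image c))"
    using f \<open>bij f\<close> \<open>inj f\<close> by (simp add: inside_linear_image closure_injective_linear_image)
  finally show ?thesis
    by (simp add: inj_image_subset_iff[OF \<open>inj f\<close>])
qed

lemma polygon_subset_closure_interior:
  assumes "polygon K"
  shows "K \<subseteq> closure (interior K)"
proof -
  from assms obtain c where c: "simple_path c" "pathfinish c = pathstart c"
    and K: "K = path_image c \<union> inside (path_image c)"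
    unfolding polygon_def by blast
  have "inside (path_image c) \<subseteq> interior K"
    using K c by (intro interior_maximal) (auto intro: open_inside closed_simple_path_image)
  then show ?thesis
    using K Jordan_curve_subset_closure_inside[OF c] closure_mono closure_subset by blast
qed

lemma closed_polygon: "polygon K \<Longrightarrow> closed K"
  by (auto simp: polygon_def intro!: closed_path_image_Un_inside simple_path_imp_path)

text \<open>A value above the essential supremum would persist near \<open>z\<close> by continuity.
  As \<open>z\<close> is a limit of interior points, it would persist on a nonempty open set, which
  is not null.\<close>

lemma le_esssup_lebesgue_on:
  fixes f :: "'a::euclidean_space \<Rightarrow> real"
  assumes S: "S \<in> sets lebesgue" "S \<subseteq> closure (interior S)"
    and f: "continuous_on S f" and "z \<in> S"
  shows "ereal (f z) \<le> esssup (lebesgue_on S) (\<lambda>x. ereal (f x))" (is "_ \<le> ?M")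
proof (rule ccontr)
  assume "\<not> ?thesis"
  \<comment> \<open>\<open>?M\<close> is an extended real; a real \<open>m\<close> in between makes
    \<open>f z - m\<close> a usable tolerance for continuity.\<close>
  then obtain m where m: "?M < ereal m" "m < f z"
    by (metis ereal_dense2 less_ereal.simps(1) not_le)
  obtain r where "r > 0" and r: "\<And>u. u \<in> S \<Longrightarrow> dist u z < r \<Longrightarrow> dist (f u) (f z) < f z - m"
    using f \<open>z \<in> S\<close> m(2) unfolding continuous_on_iff by (metis diff_gt_0_iff_gt)
  let ?U = "interior S \<inter> ball z r"
  have "?U \<noteq> {}"
  proof -
    have "z \<in> ball z r \<inter> closure (interior S)"
      using S(2) \<open>z \<in> S\<close> \<open>r > 0\<close> by auto
    then show ?thesis
      using open_Int_closure_eq_empty[of "ball z r" "interior S"] by blast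
  qed
  have ae: "AE u in lebesgue. u \<in> S \<longrightarrow> ereal (f u) \<le> ?M"
    using esssup_AE[of "\<lambda>x. ereal (f x)" "lebesgue_on S"] S(1) by (subst (asm) AE_restrict_space_iff) auto
  have gt: "ereal (f u) > ?M" if "u \<in> ?U" for u
  proof -
    have "m < f u"
      using r[of u] that interior_subset[of S] by (force simp: dist_commute dist_real_def)
    then show ?thesis
      using m(1) by (metis less_ereal.simps(1) less_trans)
  qed
  from ae have "AE u in lebesgue. u \<notin> ?U"
  proof (elim eventually_mono, intro notI)
    fix u assume le: "u \<in> S \<longrightarrow> ereal (f u) \<le> ?M" and u: "u \<in> ?U"
    have "u \<in> S"
      using u interior_subset[of S] by blast
    then show False
      using le gt[OF u] by (metis not_le)
  qed
  then have "?U \<in> null_sets lebesgue"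
    by (simp add: AE_iff_null_sets open_Int)
  then show False
    using open_not_negligible[of ?U] \<open>?U \<noteq> {}\<close>
    by (metis negligible_iff_null_sets open_Int open_ball open_interior)
qed

lemma norm_le_of_Linf_norm_le:
  assumes S: "closed S" "S \<subseteq> closure (interior S)"
    and f: "continuous_on S f" and "Linf_norm S f \<le> ereal B" and "z \<in> S"
  shows "norm (f z) \<le> B"
proof -
  have "ereal (norm (f z)) \<le> Linf_norm S f"
    unfolding Linf_norm_def using assms by (intro le_esssup_lebesgue_on continuous_on_norm) auto
  also have "\<dots> \<le> ereal B"
    by fact
  finally show ?thesis
    by simp
qed

text \<open>Linearity and expansion in the axis basis suffice, whichever derivative within
  \<open>S\<close> the choice operator selects.\<close>

lemma frechet_derivative_eq_grad_within:
  assumes "g differentiable (at z within S)"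
  shows "frechet_derivative g (at z within S) v = grad_within S g z \<bullet> v"
proof -
  let ?D = "frechet_derivative g (at z within S)"
  have "linear ?D"
    using assms by (rule linear_frechet_derivative)
  then have "?D (\<Sum>i\<in>UNIV. v $ i *\<^sub>R axis i 1) = (\<Sum>i\<in>UNIV. v $ i * ?D (axis i 1))"
    by (simp add: linear_sum linear_scale)
  moreover have "(\<Sum>i\<in>UNIV. v $ i *\<^sub>R axis i 1) = v"
    using basis_expansion[of v] by (simp add: scalar_mult_eq_scaleR)
  ultimately show ?thesis
    by (simp add: grad_within_def inner_vec_def mult.commute)
qed

text \<open>A derivative within \<open>S\<close> is also one within the segment, so the mean value
  inequality applies even along the boundary of \<open>S\<close>. Cauchy-Schwarz bounds the operator
  norm by the gradient.\<close>

lemma abs_diff_le_grad_within: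
  assumes diff: "g differentiable_on S" and seg: "closed_segment a b \<subseteq> S"
    and B: "\<And>z. z \<in> S \<Longrightarrow> norm (grad_within S g z) \<le> B"
  shows "\<bar>g a - g b\<bar> \<le> B * norm (a - b)"
proof -
  have "norm (g a - g b) \<le> B * norm (a - b)"
  proof (rule differentiable_bound)
    fix z assume z: "z \<in> closed_segment a b"
    then have d: "g differentiable (at z within S)"
      using diff seg by (auto simp: differentiable_on_def)
    then show "(g has_derivative frechet_derivative g (at z within S)) (at z within closed_segment a b)"
      using seg frechet_derivative_works has_derivative_subset by blast
    show "onorm (frechet_derivative g (at z within S)) \<le> B"
    proof (rule onorm_le)
      fix v
      have "norm (grad_within S g z \<bullet> v) \<le> norm (grad_within S g z) * norm v"
        by (rule Cauchy_Schwarz_ineq2[folded real_norm_def])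
      also have "\<dots> \<le> B * norm v"
        using z seg B by (intro mult_right_mono) auto
      finally show "norm (frechet_derivative g (at z within S) v) \<le> B * norm v"
        by (simp only: frechet_derivative_eq_grad_within[OF d])
    qed
  qed auto
  then show ?thesis
    by simp
qed

theorem lemma2p2:
  fixes \<Omega> :: "(real^2) set"
    and T P :: "(real^2) set set"
    and K S :: "(real^2) set"
    and x :: "(real^2) set \<Rightarrow> real^2"
    and g :: "real^2 \<Rightarrow> real"
    and \<alpha> \<beta> :: real
  assumes mesh: "polygonal_mesh \<Omega> T"
    and K: "K \<in> T"
    and patch: "element_patch T K P"
    and S: "S = \<Union>P"
    and nodes: "sampling_nodes P x"
    and g: "C1_on S g"
    and \<alpha>: "\<alpha> > 0" "Linf_norm S g \<le> ereal (\<alpha> * linf_norm (x ` P) g)"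
    and \<beta>: "\<beta> > 0" "Linf_norm S (grad_within S g) \<le> ereal \<beta> * Linf_norm S g"
  shows "\<forall>\<delta>\<in>{0<..<1}. \<exists>\<epsilon>>0. \<epsilon> = \<delta> / (\<alpha> * \<beta>) \<and>
     (\<forall>y. sampling_nodes P y \<and> node_perturbation P \<epsilon> x y \<and>
          (\<forall>L\<in>P. closed_segment (x L) (y L) \<subseteq> S) \<longrightarrow>
          Linf_norm S g \<le> ereal (\<alpha> / (1 - \<delta>) * linf_norm (y ` P) g))"
proof (intro ballI)
  fix \<delta> :: real
  assume \<delta>: "\<delta> \<in> {0<..<1}"
  then have pos: "\<delta> / (\<alpha> * \<beta>) > 0"
    using \<alpha>(1) \<beta>(1) by simp
  have stable: "Linf_norm S g \<le> ereal (\<alpha> / (1 - \<delta>) * linf_norm (y ` P) g)"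
    if pert: "node_perturbation P (\<delta> / (\<alpha> * \<beta>)) x y"
      and seg: "\<forall>L\<in>P. closed_segment (x L) (y L) \<subseteq> S" for y
  proof -
    have P: "finite P" "P \<noteq> {}" and poly: "\<And>L. L \<in> P \<Longrightarrow> polygon L"
      using mesh patch by (auto simp: polygonal_mesh_def element_patch_def intro: finite_subset)
    have "closed S"
      unfolding S using P poly by (intro closed_Union) (auto intro: closed_polygon)
    have S_cl: "S \<subseteq> closure (interior S)"
    proof
      fix z assume "z \<in> S"
      then obtain L where L: "L \<in> P" "z \<in> L"
        using S by blast
      then have "interior L \<subseteq> interior S"
        using S by (intro interior_mono) blast
      then show "z \<in> closure (interior S)"
        using L poly polygon_subset_closure_interior closure_mono by blast
    qed
    have node_le: "\<bar>g (y L)\<bar> \<le> linf_norm (y ` P) g" if "L \<in> P" for L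
      using that P by (auto simp: linf_norm_def intro: Max_ge)
    \<comment> \<open>The maximum is attained at the node of some \<open>L\<close>, which is then
      compared with the moved node \<open>y L\<close> of the same element.\<close>
    have "linf_norm (x ` P) g \<in> (\<lambda>p. \<bar>g p\<bar>) ` x ` P"
      unfolding linf_norm_def using P by (intro Max_in) auto
    then obtain L where L: "L \<in> P" and m: "linf_norm (x ` P) g = \<bar>g (x L)\<bar>"
      by auto
    show "Linf_norm S g \<le> ereal (\<alpha> / (1 - \<delta>) * linf_norm (y ` P) g)"
    proof (cases "Linf_norm S g")
      case (real G)
      have "continuous_on S (grad_within S g)" "g differentiable_on S"
        using g by (auto simp: C1_on_def)
      \<comment> \<open>The Markov inequality becomes a bound at every point of
        \<open>S\<close>.\<close>
      then have bound: "norm (grad_within S g z) \<le> \<beta> * G" if "z \<in> S" for z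
        using norm_le_of_Linf_norm_le[of S "grad_within S g" "\<beta> * G" z] \<beta>(2) that real \<open>closed S\<close> S_cl
        by simp
      have "x L \<in> S"
        using seg L by auto
      \<comment> \<open>The gradient bound at \<open>x L\<close> supplies the sign that allows
        multiplying the distance estimate by \<open>\<beta> * G\<close>.\<close>
      then have "0 \<le> \<beta> * G"
        using bound norm_ge_zero order_trans by blast
      obtain b where b: "norm b < \<delta> / (\<alpha> * \<beta>)" "y L = x L + b"
        using pert L by (auto simp: node_perturbation_def)
      have "\<bar>g (x L) - g (y L)\<bar> \<le> \<beta> * G * norm (x L - y L)"
        using abs_diff_le_grad_within bound \<open>g differentiable_on S\<close> seg L by blast
      also have "\<dots> \<le> \<beta> * G * (\<delta> / (\<alpha> * \<beta>))"
        using b \<open>0 \<le> \<beta> * G\<close> by (intro mult_left_mono) auto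
      also have "\<dots> = \<delta> * G / \<alpha>"
        using \<beta>(1) by simp
      finally have "\<bar>g (x L)\<bar> \<le> linf_norm (y ` P) g + \<delta> * G / \<alpha>"
        using node_le[OF L] by linarith
      then have "\<alpha> * \<bar>g (x L)\<bar> \<le> \<alpha> * linf_norm (y ` P) g + \<delta> * G"
        using \<alpha>(1) by (simp add: field_simps)
      moreover have "G \<le> \<alpha> * \<bar>g (x L)\<bar>"
        using \<alpha>(2) real m by simp
      \<comment> \<open>The term \<open>\<delta> * G\<close> is absorbed on the left;
        \<open>\<delta> < 1\<close> then permits the division.\<close>
      ultimately have "(1 - \<delta>) * G \<le> \<alpha> * linf_norm (y ` P) g"
        by (simp add: algebra_simps)
      then show ?thesis
        using \<delta> real by (simp add: field_simps)
    \<comment> \<open>The value +infinity contradicts the real bound in \<open>\<alpha>(2)\<close>,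
      and for -infinity the claim is trivial.\<close>
    qed (use \<alpha>(2) in auto)
  qed
  show "\<exists>\<epsilon>>0. \<epsilon> = \<delta> / (\<alpha> * \<beta>) \<and>
     (\<forall>y. sampling_nodes P y \<and> node_perturbation P \<epsilon> x y \<and>
          (\<forall>L\<in>P. closed_segment (x L) (y L) \<subseteq> S) \<longrightarrow>
          Linf_norm S g \<le> ereal (\<alpha> / (1 - \<delta>) * linf_norm (y ` P) g))"
    using pos stable by blast
qed

end
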